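(* Let $k\ge0$, let ${}^kN=\mathbf R\times{}^kM$ be the $k$-th order extension of $N=\mathbf R\times M$ with coordinates $(t,z_{ri},\overline z_{ri})$, $0\le r\le k$, $1\le i\le m$, let $H:N\to\mathbf C$ be smooth with complete lift $H^{c^k}:{}^kN\to\mathbf C$, and let $Z_H^{c^k}$ be the vector field on ${}^kN$ given by $$Z_H^{c^k}(t,p)=\frac{\partial}{\partial t}+Z_t^{c^k}(p),\qquad t\in\mathbf R,\ p\in{}^kM,$$ where $Z_t^{c^k}$ is the vector field on ${}^kM$ determined by $i_{Z_t^{c^k}}\Phi^{c^k}=dH_t^{c^k}$ with $\Phi^{c^k}=-\mathbf i\,d\overline z_{ri}\wedge dz_{ri}$ and $H_t^{c^k}=H^{c^k}(t,\cdot)$. Let $\epsilon>0$, $I=(-\epsilon,\epsilon)$, and let $\alpha^{k+1}:I\to{}^kN$, $\alpha^{k+1}(t)=(t,z_{ri}(t),\overline z_{ri}(t))$, be an integral curve of $Z_H^{c^k}$, i.e. $\dot\alpha^{k+1}(t)=Z_H^{c^k}(\alpha^{k+1}(t))$ for all $t\in I$. Then along the curve, for all $0\le r\le k$ and $1\le i\le m$, $$\frac{dz_{ri}}{dt}=\frac1{\mathbf i}\frac{\partial H^{c^k}}{\partial\overline z_{ri}},\qquad \frac{d\overline z_{ri}}{dt}=-\frac1{\mathbf i}\frac{\partial H^{c^k}}{\partial z_{ri}}.$$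
   Context: All objects are smooth; repeated indices are summed; $\mathbf i=\sqrt{-1}$. Everything is expressed in a coordinate chart. $M$ is a Kaehlerian manifold of complex dimension $m$ with local complex coordinates $(z_{0i},\overline z_{0i})$, $1\le i\le m$. Its $k$-th order extension ${}^kM$ (with ${}^0M=M$) has local coordinates $(z_{ri},\overline z_{ri})$, $0\le r\le k$, $1\le i\le m$ (indices written up or down interchangeably); the projection ${}^kM\to{}^{k-1}M$ forgets the coordinates with $r=k$. Vector fields are allowed to be complex, i.e. complex combinations of $\partial/\partial t$, $\partial/\partial z_{ri}$ and $\partial/\partial\overline z_{ri}$; the velocity of a curve $(t,z_{ri}(t),\overline z_{ri}(t))$ is $\frac{\partial}{\partial t}+\frac{dz_{ri}}{dt}\frac{\partial}{\partial z_{ri}}+\frac{d\overline z_{ri}}{dt}\frac{\partial}{\partial\overline z_{ri}}$. Lifts of functions: $v$ denotes pullback of a function from ${}^{k-1}N$ to ${}^kN$ along the projection. The complete lift of $f:N\to\mathbf C$ is defined recursively by $f^{c^0}=f$ and $$f^{c^k}=t\Big(\frac{\partial f^{c^{k-1}}}{\partial t}\Big)^{v}+\dot z^{ri}\Big(\frac{\partial f^{c^{k-1}}}{\partial z^{ri}}\Big)^{v}+\dot{\overline z}^{ri}\Big(\frac{\partial f^{c^{k-1}}}{\partial\overline z^{ri}}\Big)^{v},$$ with sums over $0\le r\le k-1$, $1\le i\le m$, where $\dot z^{ri}=z^{(r+1)i}$, $\dot{\overline z}^{ri}=\overline z^{(r+1)i}$ are coordinates of ${}^kN$. *)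

theory Defs
  imports "HOL-Analysis.Analysis"
begin

section \<open>Smooth maps\<close>

fun Ck_on :: "nat \<Rightarrow> 'a::real_normed_vector set \<Rightarrow> ('a \<Rightarrow> 'b::real_normed_vector) \<Rightarrow> bool" where
  "Ck_on 0 S f \<longleftrightarrow> continuous_on S f"
| "Ck_on (Suc n) S f \<longleftrightarrow>
     (\<forall>x\<in>S. f differentiable (at x)) \<and>
     (\<forall>v. Ck_on n S (\<lambda>x. frechet_derivative f (at x) v))"

text \<open>Intended for open sets.\<close>

definition smooth_on :: "'a::real_normed_vector set \<Rightarrow> ('a \<Rightarrow> 'b::real_normed_vector) \<Rightarrow> bool" where
  "smooth_on S f \<longleftrightarrow> (\<forall>n. Ck_on n S f)"

section \<open>Higher order extensions in a coordinate chart\<close>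

text \<open>
  The manifold is represented by the image \<open>U\<close> of a chart, an open subset of
  \<open>complex ^ 'm\<close> with \<open>m = CARD('m)\<close>. The order varies inside the definition of the
  complete lift, so points of all the extensions live in one type: \<open>p r $ i\<close> is the
  coordinate \<open>z_ri\<close>, and a point of the extension of order \<open>k\<close> vanishes at \<open>r > k\<close>.
  The coordinate conjugate to \<open>z_ri\<close> is \<open>cnj (p r $ i)\<close>.
\<close>

type_synonym 'm pt = "nat \<Rightarrow> complex ^ 'm"

definition ext_M :: "nat \<Rightarrow> (complex ^ 'm) set \<Rightarrow> 'm::finite pt set" where
  "ext_M k U = {p. p 0 \<in> U \<and> (\<forall>r>k. p r = 0)}"

definition ext_N :: "nat \<Rightarrow> (complex ^ 'm) set \<Rightarrow> (real \<times> 'm::finite pt) set" where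
  "ext_N k U = UNIV \<times> ext_M k U"

definition proj_M :: "nat \<Rightarrow> 'm pt \<Rightarrow> 'm::finite pt" where
  "proj_M k p = (\<lambda>r. if r < k then p r else 0)"

definition v_lift :: "nat \<Rightarrow> (real \<times> 'm pt \<Rightarrow> complex) \<Rightarrow> real \<times> 'm::finite pt \<Rightarrow> complex" where
  "v_lift k f = (\<lambda>(t, p). f (t, proj_M k p))"

section \<open>Partial derivatives\<close>

definition dir_deriv :: "nat \<Rightarrow> complex ^ 'm \<Rightarrow> ('m pt \<Rightarrow> complex) \<Rightarrow> 'm::finite pt \<Rightarrow> complex" where
  "dir_deriv r w f p = vector_derivative (\<lambda>s::real. f (p(r := p r + s *\<^sub>R w))) (at 0)"

text \<open>
  With \<open>z = x + \<i> y\<close>, the directions \<open>axis i 1\<close> and \<open>axis i \<i>\<close> are those of \<open>x_ri\<close> and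
  \<open>y_ri\<close>; the derivatives along \<open>z_ri\<close> and its conjugate are the Wirtinger derivatives.
\<close>

definition d_z :: "nat \<Rightarrow> 'm \<Rightarrow> ('m pt \<Rightarrow> complex) \<Rightarrow> 'm::finite pt \<Rightarrow> complex" where
  "d_z r i f p = (dir_deriv r (axis i 1) f p - \<i> * dir_deriv r (axis i \<i>) f p) / 2"

definition d_zbar :: "nat \<Rightarrow> 'm \<Rightarrow> ('m pt \<Rightarrow> complex) \<Rightarrow> 'm::finite pt \<Rightarrow> complex" where
  "d_zbar r i f p = (dir_deriv r (axis i 1) f p + \<i> * dir_deriv r (axis i \<i>) f p) / 2"

definition Nd_t :: "(real \<times> 'm pt \<Rightarrow> complex) \<Rightarrow> real \<times> 'm::finite pt \<Rightarrow> complex" where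
  "Nd_t f = (\<lambda>(t, p). vector_derivative (\<lambda>s. f (s, p)) (at t))"

definition Nd_z :: "nat \<Rightarrow> 'm \<Rightarrow> (real \<times> 'm pt \<Rightarrow> complex) \<Rightarrow> real \<times> 'm::finite pt \<Rightarrow> complex" where
  "Nd_z r i f = (\<lambda>(t, p). d_z r i (\<lambda>q. f (t, q)) p)"

definition Nd_zbar :: "nat \<Rightarrow> 'm \<Rightarrow> (real \<times> 'm pt \<Rightarrow> complex) \<Rightarrow> real \<times> 'm::finite pt \<Rightarrow> complex" where
  "Nd_zbar r i f = (\<lambda>(t, p). d_zbar r i (\<lambda>q. f (t, q)) p)"

section \<open>Complete lifts of functions\<close>

primrec c_lift :: "(real \<times> (complex ^ 'm) \<Rightarrow> complex) \<Rightarrow> nat \<Rightarrow> real \<times> 'm::finite pt \<Rightarrow> complex" where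
  "c_lift f 0 = (\<lambda>(t, p). f (t, p 0))"
| "c_lift f (Suc k) = (\<lambda>(t, p).
     of_real t * v_lift (Suc k) (Nd_t (c_lift f k)) (t, p)
     + (\<Sum>r\<le>k. \<Sum>i\<in>UNIV. p (Suc r) $ i * v_lift (Suc k) (Nd_z r i (c_lift f k)) (t, p))
     + (\<Sum>r\<le>k. \<Sum>i\<in>UNIV. cnj (p (Suc r) $ i) * v_lift (Suc k) (Nd_zbar r i (c_lift f k)) (t, p)))"

section \<open>Complex tangent vectors and forms\<close>

text \<open>
  The pair \<open>(a, b)\<close> stands for the complex tangent vector with coefficients \<open>a r $ i\<close> along
  \<open>z_ri\<close> and \<open>b r $ i\<close> along its conjugate. For a tangent vector of the extension of \<open>N\<close>
  there is in front the coefficient along \<open>t\<close>. Forms are complex multilinear functions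
  of such vectors.
\<close>

type_synonym 'm tvec = "'m pt \<times> 'm pt"

definition tvecs :: "nat \<Rightarrow> 'm::finite tvec set" where
  "tvecs k = {(a, b). \<forall>r>k. a r = 0 \<and> b r = 0}"

definition form_dz :: "nat \<Rightarrow> 'm \<Rightarrow> 'm::finite tvec \<Rightarrow> complex" where
  "form_dz r i X = fst X r $ i"

definition form_dzbar :: "nat \<Rightarrow> 'm \<Rightarrow> 'm::finite tvec \<Rightarrow> complex" where
  "form_dzbar r i X = snd X r $ i"

definition wedge :: "('v \<Rightarrow> complex) \<Rightarrow> ('v \<Rightarrow> complex) \<Rightarrow> 'v \<Rightarrow> 'v \<Rightarrow> complex" where
  "wedge \<alpha> \<beta> X Y = \<alpha> X * \<beta> Y - \<alpha> Y * \<beta> X"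

definition interior_product :: "'v \<Rightarrow> ('v \<Rightarrow> 'v \<Rightarrow> complex) \<Rightarrow> 'v \<Rightarrow> complex" where
  "interior_product Z \<omega> = (\<lambda>X. \<omega> Z X)"

definition Phi :: "nat \<Rightarrow> 'm::finite tvec \<Rightarrow> 'm tvec \<Rightarrow> complex" where
  "Phi k X Y = - \<i> * (\<Sum>r\<le>k. \<Sum>i\<in>UNIV. wedge (form_dzbar r i) (form_dz r i) X Y)"

definition differential :: "nat \<Rightarrow> ('m::finite pt \<Rightarrow> complex) \<Rightarrow> 'm pt \<Rightarrow> 'm tvec \<Rightarrow> complex" where
  "differential k f p X =
     (\<Sum>r\<le>k. \<Sum>i\<in>UNIV. d_z r i f p * form_dz r i X + d_zbar r i f p * form_dzbar r i X)"

section \<open>Hamiltonian vector fields and integral curves\<close>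

text \<open>\<open>Phi k\<close> is nondegenerate on \<open>tvecs k\<close>, so the description below has exactly one solution.\<close>

definition Z_field :: "nat \<Rightarrow> (real \<times> (complex ^ 'm) \<Rightarrow> complex) \<Rightarrow> real \<Rightarrow> 'm::finite pt \<Rightarrow> 'm tvec" where
  "Z_field k H t p = (THE Z. Z \<in> tvecs k \<and>
     (\<forall>X\<in>tvecs k. interior_product Z (Phi k) X = differential k (\<lambda>q. c_lift H k (t, q)) p X))"

definition ZH_field :: "nat \<Rightarrow> (real \<times> (complex ^ 'm) \<Rightarrow> complex) \<Rightarrow> real \<times> 'm::finite pt \<Rightarrow> complex \<times> 'm tvec" where
  "ZH_field k H = (\<lambda>(t, p). (1, Z_field k H t p))"

definition velocity :: "(real \<Rightarrow> real \<times> 'm pt) \<Rightarrow> real \<Rightarrow> complex \<times> 'm::finite tvec" where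
  "velocity \<alpha> t =
     (of_real (vector_derivative (\<lambda>s. fst (\<alpha> s)) (at t)),
      (\<lambda>r. \<chi> i. vector_derivative (\<lambda>s. snd (\<alpha> s) r $ i) (at t)),
      (\<lambda>r. \<chi> i. vector_derivative (\<lambda>s. cnj (snd (\<alpha> s) r $ i)) (at t)))"

definition integral_curve_on ::
    "real set \<Rightarrow> (real \<times> 'm pt \<Rightarrow> complex \<times> 'm tvec) \<Rightarrow> (real \<Rightarrow> real \<times> 'm::finite pt) \<Rightarrow> bool" where
  "integral_curve_on I Z \<alpha> \<longleftrightarrow> (\<forall>t\<in>I. velocity \<alpha> t = Z (\<alpha> t))"

end

theory Submission
  imports Defs
begin

text \<open>In these coordinates \<open>Phi k\<close> has constant coefficients and pairs each z_ri
  only with its own conjugate. Contracting it with a vector of coefficients (a, b) gives the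
  covector with coefficient -\<i> b along dz_ri and \<i> a along the conjugate differential.
  Comparing with the Wirtinger coefficients of the differential of the lifted Hamiltonian and
  dividing by \<i> determines the field (\<open>Z_field_eq\<close>). An integral curve has this
  field as its velocity, so Hamilton's equations are the components of that identity.\<close>

text \<open>Evaluation on the coordinate vectors isolates each coefficient. The two families
  separate because a complex tangent vector may have a component along z_ri and none along its
  conjugate.\<close>

lemma covector_coefficients_unique:
  fixes f g f' g' :: "nat \<Rightarrow> 'm::finite \<Rightarrow> complex"
  assumes eq: "\<And>X. X \<in> tvecs k \<Longrightarrow>
      (\<Sum>r\<le>k. \<Sum>i\<in>UNIV. f r i * form_dz r i X + g r i * form_dzbar r i X) =
      (\<Sum>r\<le>k. \<Sum>i\<in>UNIV. f' r i * form_dz r i X + g' r i * form_dzbar r i X)"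
    and r: "r \<le> k"
  shows "f r i = f' r i" and "g r i = g' r i"
proof -
  define e :: "'m pt" where "e = (\<lambda>s. if s = r then axis i 1 else 0)"
  have e: "e s $ j = (if s = r then if j = i then 1 else 0 else 0)" for s j
    by (simp add: e_def axis_def)
  have pick: "(\<Sum>s\<le>k. \<Sum>j\<in>UNIV. h s j * e s $ j) = h r i" for h :: "nat \<Rightarrow> 'm \<Rightarrow> complex"
  proof -
    have "(\<Sum>j\<in>UNIV. h s j * e s $ j) = (if s = r then h r i else 0)" for s
      by (simp add: e if_distrib[where f = "(*) c" for c] cong: if_cong)
    then show ?thesis
      using r by simp
  qed
  have "(e, \<lambda>_. 0) \<in> tvecs k" "(\<lambda>_. 0, e) \<in> tvecs k"
    using r by (auto simp: tvecs_def e_def)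
  from this[THEN eq] show "f r i = f' r i" "g r i = g' r i"
    by (simp_all add: form_dz_def form_dzbar_def pick)
qed

text \<open>Puts the contraction in the shape to which \<open>covector_coefficients_unique\<close>
  applies; the opposite signs come from the antisymmetry of the wedge.\<close>

lemma Phi_eq_sum:
  "Phi k Z X = (\<Sum>r\<le>k. \<Sum>i\<in>UNIV.
     (- \<i> * snd Z r $ i) * form_dz r i X + (\<i> * fst Z r $ i) * form_dzbar r i X)"
  unfolding Phi_def wedge_def form_dz_def form_dzbar_def sum_distrib_left
  by (intro sum.cong refl) (simp add: algebra_simps)

text \<open>The definite description is resolved by both halves of nondegeneracy: the displayed
  field solves the equation, and any solution has the same coefficients.\<close>

lemma Z_field_eq:
  fixes H :: "real \<times> (complex ^ 'm::finite) \<Rightarrow> complex"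
  shows "Z_field k H t p =
    ((\<lambda>r. if r \<le> k then \<chi> i. (1 / \<i>) * Nd_zbar r i (c_lift H k) (t, p) else 0),
     (\<lambda>r. if r \<le> k then \<chi> i. - (1 / \<i>) * Nd_z r i (c_lift H k) (t, p) else 0))"
    (is "_ = ?Z")
  unfolding Z_field_def
proof (rule the_equality)
  show "?Z \<in> tvecs k \<and> (\<forall>X\<in>tvecs k. interior_product ?Z (Phi k) X =
      differential k (\<lambda>q. c_lift H k (t, q)) p X)"
    by (auto simp: tvecs_def interior_product_def Phi_eq_sum differential_def
        Nd_z_def Nd_zbar_def intro!: sum.cong)
next
  fix Z
  assume Z: "Z \<in> tvecs k \<and> (\<forall>X\<in>tvecs k. interior_product Z (Phi k) X =
      differential k (\<lambda>q. c_lift H k (t, q)) p X)"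
  have coeff: "- \<i> * snd Z r $ i = Nd_z r i (c_lift H k) (t, p)"
      "\<i> * fst Z r $ i = Nd_zbar r i (c_lift H k) (t, p)" if "r \<le> k" for r i
    using covector_coefficients_unique[OF _ that,
        where f = "\<lambda>r i. - \<i> * snd Z r $ i" and g = "\<lambda>r i. \<i> * fst Z r $ i"
          and f' = "\<lambda>r i. Nd_z r i (c_lift H k) (t, p)"
          and g' = "\<lambda>r i. Nd_zbar r i (c_lift H k) (t, p)"] Z
    by (simp_all add: interior_product_def Phi_eq_sum differential_def Nd_z_def Nd_zbar_def)
  \<comment> \<open>For \<open>r \<le> k\<close> the reversed \<open>coeff\<close> replaces the
    partial derivatives in \<open>?Z\<close> by components of \<open>Z\<close>, and the factors \<i>
    cancel. For larger \<open>r\<close> both sides vanish, \<open>Z\<close> because it lies in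
    \<open>tvecs k\<close>.\<close>
  have "fst Z r = fst ?Z r" "snd Z r = snd ?Z r" for r
    using Z coeff[of r, symmetric] by (auto simp: tvecs_def vec_eq_iff)
  then show "Z = ?Z"
    by (intro prod_eqI ext)
qed

lemma smooth_on_imp_differentiable:
  assumes "smooth_on S f" "x \<in> S"
  shows "f differentiable (at x)"
  using assms Ck_on.simps(2)[of 0 S f] unfolding smooth_on_def by blast

text \<open>A derivative depends only on the germ. This is needed because \<open>\<alpha>\<close> is
  tied to \<open>z\<close> only on the open interval.\<close>

lemma vector_derivative_cong_open:
  assumes "(f has_vector_derivative f') (at x)" "open S" "x \<in> S" "\<And>y. y \<in> S \<Longrightarrow> g y = f y"
  shows "vector_derivative g (at x) = f'"
  using has_vector_derivative_transform_within_open[OF assms(1-3)] assms(4)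
  by (simp add: vector_derivative_at)

theorem mainTheorem3:
  fixes U :: "(complex ^ 'm::finite) set"
    and H :: "real \<times> (complex ^ 'm) \<Rightarrow> complex"
    and k :: nat
    and \<epsilon> :: real
    and z :: "real \<Rightarrow> 'm pt"
    and \<alpha> :: "real \<Rightarrow> real \<times> 'm pt"
  assumes "open U"
    and "smooth_on (UNIV \<times> U) H"
    and "\<epsilon> > 0"
    and "\<forall>t\<in>{-\<epsilon><..<\<epsilon>}. \<alpha> t = (t, z t)"
    and "\<alpha> ` {-\<epsilon><..<\<epsilon>} \<subseteq> ext_N k U"
    and "\<forall>r\<le>k. smooth_on {-\<epsilon><..<\<epsilon>} (\<lambda>t. z t r)"
    and "integral_curve_on {-\<epsilon><..<\<epsilon>} (ZH_field k H) \<alpha>"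
  shows "\<forall>t\<in>{-\<epsilon><..<\<epsilon>}. \<forall>r\<le>k. \<forall>i.
     ((\<lambda>s. z s r $ i) has_vector_derivative
        (1 / \<i>) * Nd_zbar r i (c_lift H k) (\<alpha> t)) (at t) \<and>
     ((\<lambda>s. cnj (z s r $ i)) has_vector_derivative
        - (1 / \<i>) * Nd_z r i (c_lift H k) (\<alpha> t)) (at t)"
proof (intro ballI allI impI)
  fix t r i
  assume t: "t \<in> {-\<epsilon><..<\<epsilon>}" and r: "r \<le> k"
  \<comment> \<open>\<open>velocity\<close> is built from \<open>vector_derivative\<close>, whose
    value says nothing unless a derivative exists; smoothness of the curve supplies one.\<close>
  have "(\<lambda>s. z s r) differentiable (at t)"
    using assms(6) r t by (blast intro: smooth_on_imp_differentiable)
  then obtain D where "((\<lambda>s. z s r) has_vector_derivative D) (at t)"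
    by (auto simp: vector_derivative_works)
  then have z: "((\<lambda>s. z s r $ i) has_vector_derivative D $ i) (at t)"
    by (rule bounded_linear.has_vector_derivative[OF bounded_linear_vec_nth])
  then have z': "((\<lambda>s. cnj (z s r $ i)) has_vector_derivative cnj (D $ i)) (at t)"
    by (rule has_vector_derivative_cnj)
  have \<alpha>: "\<alpha> s = (s, z s)" if "s \<in> {-\<epsilon><..<\<epsilon>}" for s
    using assms(4) that by blast
  have "vector_derivative (\<lambda>s. snd (\<alpha> s) r $ i) (at t) = D $ i"
    by (rule vector_derivative_cong_open[OF z open_greaterThanLessThan t]) (simp add: \<alpha>)
  moreover have "vector_derivative (\<lambda>s. cnj (snd (\<alpha> s) r $ i)) (at t) = cnj (D $ i)"
    by (rule vector_derivative_cong_open[OF z' open_greaterThanLessThan t]) (simp add: \<alpha>)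
  moreover have "velocity \<alpha> t = (1, Z_field k H t (z t))"
    using assms(7) t by (simp add: integral_curve_on_def ZH_field_def \<alpha>)
  then have "fst (snd (velocity \<alpha> t)) r $ i = fst (Z_field k H t (z t)) r $ i"
      "snd (snd (velocity \<alpha> t)) r $ i = snd (Z_field k H t (z t)) r $ i"
    by simp_all
  \<comment> \<open>Here \<open>r \<le> k\<close> selects the nontrivial branch of
    \<open>Z_field_eq\<close>.\<close>
  ultimately have "D $ i = (1 / \<i>) * Nd_zbar r i (c_lift H k) (\<alpha> t)"
      "cnj (D $ i) = - (1 / \<i>) * Nd_z r i (c_lift H k) (\<alpha> t)"
    using r t by (simp_all add: velocity_def Z_field_eq \<alpha>)
  with z z' show "((\<lambda>s. z s r $ i) has_vector_derivative
        (1 / \<i>) * Nd_zbar r i (c_lift H k) (\<alpha> t)) (at t) \<and>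
     ((\<lambda>s. cnj (z s r $ i)) has_vector_derivative
        - (1 / \<i>) * Nd_z r i (c_lift H k) (\<alpha> t)) (at t)"
    by metis
qed

end
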